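(* Let $q$ be a prime power, $m,k,n$ positive integers with $k\le n$, and let $\mathcal{C}$ be an $[n,k]_{q^m/q}$ near MRD code. Then $m\ge k$ and $$n\le\begin{cases} m+2 & \text{if } m=2k-2,\\ m+1 & \text{if } m\ne 2k-2.\end{cases}$$ Moreover, for an integer $k\ge 2$ and a nondegenerate $[2k,k]_{q^{2k-2}/q}$ code $\mathcal{C}$, the code $\mathcal{C}$ is a $[2k,k,k]_{q^{2k-2}/q}$ near MRD code if and only if every $[2k,k]_{q^{2k-2}/q}$ system associated with $\mathcal{C}$ is maximum $(k-2)$-scattered.
   Context: Rank weight of $v\in\mathbb{F}_{q^m}^n$: $\dim_{\mathbb{F}_q}$ of the $\mathbb{F}_q$-span of its entries. An $[n,k]_{q^m/q}$ code is a $k$-dimensional $\mathbb{F}_{q^m}$-subspace $\mathcal{C}$ of $\mathbb{F}_{q^m}^n$; $[n,k,d]_{q^m/q}$ indicates minimum rank distance (least rank weight of a nonzero codeword) $d=d_{\mathrm{rk}}(\mathcal{C})$. $\mathcal{C}$ is nondegenerate if the $\mathbb{F}_q$-span of the columns of a generator matrix (a $k\times n$ matrix whose rows span $\mathcal{C}$) has $\mathbb{F}_q$-dimension $n$. An $\mathbb{F}_{q^m}$-subspace of $\mathbb{F}_{q^m}^n$ is Galois closed if invariant under the coordinatewise $q$-Frobenius map; for $1\le s\le k$, $d_{\mathrm{rk},s}(\mathcal{C})$ is the minimum $\mathbb{F}_{q^m}$-dimension of a Galois closed subspace $\mathcal{A}$ with $\dim_{\mathbb{F}_{q^m}}(\mathcal{A}\cap\mathcal{C})\ge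 s$. $\mathcal{C}$ is near MRD if $d_{\mathrm{rk}}(\mathcal{C})=n-k$ and $d_{\mathrm{rk},s}(\mathcal{C})=n-k+s$ for all $2\le s\le k$. An $[n,k]_{q^m/q}$ system is an $n$-dimensional $\mathbb{F}_q$-subspace $\mathcal{U}$ of $\mathbb{F}_{q^m}^k$ spanning $\mathbb{F}_{q^m}^k$ over $\mathbb{F}_{q^m}$. For nondegenerate $\mathcal{C}$ with generator matrix $G$, the systems associated with $\mathcal{C}$ are $\langle g_1,\dots,g_n\rangle_{\mathbb{F}_q}M$ with $g_i$ the columns of $G$ and $M\in\mathrm{GL}(k,q^m)$. For $0\le h<k$, $\mathcal{U}$ is $h$-scattered if $\dim_{\mathbb{F}_q}(\mathcal{U}\cap W)\le h$ for every $h$-dimensional $\mathbb{F}_{q^m}$-subspace $W$ of $\mathbb{F}_{q^m}^k$; it is maximum $h$-scattered if moreover $\dim_{\mathbb{F}_q}\mathcal{U}=\frac{km}{h+1}$. *)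

theory Defs
  imports "HOL-Analysis.Analysis" "HOL-Number_Theory.Prime_Powers"
begin

text \<open>
  The extension $\mathbb{F}_{q^m}/\mathbb{F}_q$ is a field embedding \<open>emb\<close> of a finite field type
  \<open>'f\<close> with $q$ elements into a finite field type \<open>'a\<close> with $q^m$ elements. Notions over
  $\mathbb{F}_{q^m}$ are those of the library's \<open>vec\<close> interpretation; notions over $\mathbb{F}_q$
  are the generic ones of \<open>module\<close> and \<open>vector_space\<close> for the scalar multiplications below.
\<close>

locale field_embedding =
  fixes emb :: "'f::field \<Rightarrow> 'a::field"
  assumes emb_one: "emb 1 = 1"
    and emb_add: "emb (x + y) = emb x + emb y"
    and emb_mult: "emb (x * y) = emb x * emb y"

definition base_scale :: "('f::field \<Rightarrow> 'a::field) \<Rightarrow> 'f \<Rightarrow> 'a \<Rightarrow> 'a" where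
  "base_scale emb c x = emb c * x"

definition base_vscale :: "('f::field \<Rightarrow> 'a::field) \<Rightarrow> 'f \<Rightarrow> 'a^'n \<Rightarrow> 'a^'n" where
  "base_vscale emb c v = emb c *s v"

lemma (in field_embedding) vector_space_base_scale: "vector_space (base_scale emb)"
  by unfold_locales
    (simp_all add: base_scale_def emb_one emb_add emb_mult algebra_simps)

lemma (in field_embedding) vector_space_base_vscale:
  "vector_space (base_vscale emb :: 'f \<Rightarrow> 'a^'n \<Rightarrow> 'a^'n)"
  by unfold_locales
    (simp_all add: base_vscale_def emb_one emb_add emb_mult vec_eq_iff algebra_simps)

abbreviation Fq_subspace :: "('f::field \<Rightarrow> 'a::field) \<Rightarrow> ('a^'n) set \<Rightarrow> bool" where
  "Fq_subspace emb \<equiv> module.subspace (base_vscale emb)"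

abbreviation Fq_span :: "('f::field \<Rightarrow> 'a::field) \<Rightarrow> ('a^'n) set \<Rightarrow> ('a^'n) set" where
  "Fq_span emb \<equiv> module.span (base_vscale emb)"

abbreviation Fq_dim :: "('f::field \<Rightarrow> 'a::field) \<Rightarrow> ('a^'n) set \<Rightarrow> nat" where
  "Fq_dim emb \<equiv> vector_space.dim (base_vscale emb)"

definition rank_weight :: "('f::field \<Rightarrow> 'a::field) \<Rightarrow> 'a^'n \<Rightarrow> nat" where
  "rank_weight emb v =
     vector_space.dim (base_scale emb) (module.span (base_scale emb) {v $ i | i. i \<in> UNIV})"

text \<open>An $[n,k]_{q^m/q}$ code, where $n$ is the size of the index type \<open>'n\<close>.\<close>

definition rank_code :: "nat \<Rightarrow> ('a::field^'n) set \<Rightarrow> bool" where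
  "rank_code k C \<longleftrightarrow> vec.subspace C \<and> vec.dim C = k"

definition min_rank_distance :: "('f::field \<Rightarrow> 'a::field) \<Rightarrow> ('a^'n) set \<Rightarrow> nat" where
  "min_rank_distance emb C = (LEAST d. \<exists>c\<in>C. c \<noteq> 0 \<and> rank_weight emb c = d)"

definition galois_closed :: "nat \<Rightarrow> ('a::field^'n) set \<Rightarrow> bool" where
  "galois_closed q A \<longleftrightarrow> vec.subspace A \<and> (\<forall>v\<in>A. (\<chi> i. (v $ i) ^ q) \<in> A)"

definition gen_rank_weight :: "nat \<Rightarrow> nat \<Rightarrow> ('a::field^'n) set \<Rightarrow> nat" where
  "gen_rank_weight q s C =
     (LEAST d. \<exists>A. galois_closed q A \<and> s \<le> vec.dim (A \<inter> C) \<and> vec.dim A = d)"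

definition near_MRD ::
  "('f::{field,finite} \<Rightarrow> 'a::field) \<Rightarrow> nat \<Rightarrow> ('a^'n) set \<Rightarrow> bool" where
  "near_MRD emb k C \<longleftrightarrow> rank_code k C \<and>
     min_rank_distance emb C = CARD('n) - k \<and>
     (\<forall>s. 2 \<le> s \<and> s \<le> k \<longrightarrow> gen_rank_weight CARD('f) s C = CARD('n) - k + s)"

text \<open>The \<open>'k\<close>-indexed rows of a generator matrix span \<open>C\<close>; it is meant for codes of dimension
  \<open>CARD('k)\<close>, so that the rows then form a basis of \<open>C\<close>.\<close>

definition generator_matrix :: "'a::field^'n^'k \<Rightarrow> ('a^'n) set \<Rightarrow> bool" where
  "generator_matrix G C \<longleftrightarrow> vec.span (rows G) = C"

text \<open>The type argument carries the number of rows of the generator matrices. The dimension below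
  does not depend on the choice of the generator matrix.\<close>

definition nondegenerate ::
  "'k::finite itself \<Rightarrow> ('f::field \<Rightarrow> 'a::field) \<Rightarrow> ('a^'n) set \<Rightarrow> bool" where
  "nondegenerate _ emb C \<longleftrightarrow>
     (\<exists>G :: 'a^'n^'k. generator_matrix G C \<and> Fq_dim emb (Fq_span emb (columns G)) = CARD('n))"

text \<open>An $[n,k]_{q^m/q}$ system, where $k$ is the size of the index type \<open>'k\<close>.\<close>

definition rank_system :: "('f::field \<Rightarrow> 'a::field) \<Rightarrow> nat \<Rightarrow> ('a^'k) set \<Rightarrow> bool" where
  "rank_system emb n U \<longleftrightarrow> Fq_subspace emb U \<and> Fq_dim emb U = n \<and> vec.span U = UNIV"

definition associated_systems ::
  "('f::field \<Rightarrow> 'a::field) \<Rightarrow> ('a^'n) set \<Rightarrow> ('a^'k) set set" where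
  "associated_systems emb C =
     {(\<lambda>u. u v* M) ` Fq_span emb (columns G) | (G :: 'a^'n^'k) (M :: 'a^'k^'k).
        generator_matrix G C \<and> invertible M}"

definition scattered :: "('f::field \<Rightarrow> 'a::field) \<Rightarrow> nat \<Rightarrow> ('a^'k) set \<Rightarrow> bool" where
  "scattered emb h U \<longleftrightarrow> h < CARD('k) \<and>
     (\<forall>W. vec.subspace W \<and> vec.dim W = h \<longrightarrow> Fq_dim emb (U \<inter> W) \<le> h)"

text \<open>\<open>m\<close> is the degree of the extension.\<close>

definition maximum_scattered ::
  "('f::field \<Rightarrow> 'a::field) \<Rightarrow> nat \<Rightarrow> nat \<Rightarrow> ('a^'k) set \<Rightarrow> bool" where
  "maximum_scattered emb m h U \<longleftrightarrow> scattered emb h U \<and>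
     real (Fq_dim emb U) = real (CARD('k) * m) / real (h + 1)"

end

theory Submission
  imports Defs
begin

text \<open>
  Everything is expressed through the dual code, using that Galois closed subspaces are exactly
  those spanned by vectors with entries in the base field. For \<open>k \<ge> 2\<close> the second generalized
  weight being \<open>n - k + 2\<close> is equivalent to the dual having minimum distance at least \<open>k\<close>, and this
  already determines all higher weights. Hence for a near MRD code the Singleton bound applies to
  the code with distance \<open>n - k\<close> and to its dual with distance \<open>k\<close>. Comparing the two inequalities
  when \<open>n \<ge> m + 2\<close> leaves only \<open>n = m + 2\<close>, \<open>m = 2 k - 2\<close>.

  A system is \<open>(k - 2)\<close>-scattered iff the dual code has minimum distance at least \<open>k\<close>. For \<open>n = 2 k\<close>
  and \<open>m = 2 k - 2\<close> the dual then attains the Singleton bound, so by Delsarte duality the code itself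
  attains the largest distance allowed, which is \<open>k\<close>.
\<close>

section \<open>Sizes of subspaces over a finite field\<close>

locale finite_vector_space = vector_space scale
  for scale :: "'f::{field,finite} \<Rightarrow> 'b::{ab_group_add,finite} \<Rightarrow> 'b"
begin

sublocale finite_dimensional_vector_space scale "extend_basis {}"
  using independent_extend_basis[OF independent_empty] span_extend_basis[OF independent_empty]
  by unfold_locales auto

lemma card_span_independent:
  assumes "independent B"
  shows "card (span B) = CARD('f) ^ card B"
proof -
  define f where "f u = (\<Sum>b\<in>B. scale (u b) b)" for u
  have inj: "inj_on f (B \<rightarrow>\<^sub>E UNIV)"
  proof (rule inj_onI)
    fix u v assume uv: "u \<in> B \<rightarrow>\<^sub>E UNIV" "v \<in> B \<rightarrow>\<^sub>E UNIV" "f u = f v"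
    have "(\<Sum>b\<in>B. scale (u b - v b) b) = 0"
      using uv(3) by (simp add: f_def scale_left_diff_distrib sum_subtractf)
    then have "u b - v b = 0" if "b \<in> B" for b
      using independentD[OF assms, of B "\<lambda>b. u b - v b" b] that by simp
    then show "u = v" using uv(1,2) by (intro PiE_ext) auto
  qed
  have "span B = f ` (B \<rightarrow>\<^sub>E UNIV)"
  proof -
    have "f u = f (restrict u B)" for u unfolding f_def by (rule sum.cong) auto
    moreover have "restrict u B \<in> B \<rightarrow>\<^sub>E UNIV" for u :: "'b \<Rightarrow> 'f" by auto
    ultimately have "range f = f ` (B \<rightarrow>\<^sub>E UNIV)" by blast
    then show ?thesis by (simp add: span_finite f_def)
  qed
  then show ?thesis using card_image[OF inj] by (simp add: card_PiE)
qed

text \<open>Turns every later comparison of sizes into a comparison of exponents. It is applied to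
  the extension as a space over the base field and to vectors over either field.\<close>

lemma card_subspace:
  assumes "subspace V"
  shows "card V = CARD('f) ^ dim V"
proof -
  obtain B where "B \<subseteq> V" "independent B" "V \<subseteq> span B" "card B = dim V"
    using basis_exists by blast
  then show ?thesis using card_span_independent assms span_minimal
    by (metis subset_antisym)
qed

end

lemma one_less_card_field: "1 < CARD('f::{field,finite})"
  using card_mono[of UNIV "{0::'f, 1}"] by simp

section \<open>Orthogonal complements\<close>

definition dotp :: "'a::field^'n \<Rightarrow> 'a^'n \<Rightarrow> 'a" where
  "dotp a x = (\<Sum>i\<in>UNIV. a $ i * x $ i)"

text \<open>The dual code for the standard bilinear form. A subspace may meet its complement
  nontrivially, so the dimension formula below is not proved by a direct sum decomposition.\<close>

definition orth :: "('a::field^'n) set \<Rightarrow> ('a^'n) set" where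
  "orth A = {x. \<forall>a\<in>A. dotp a x = 0}"

lemma dotp_commute: "dotp a x = dotp x a"
  by (simp add: dotp_def mult.commute)

lemma dotp_simps [simp]:
  "dotp a 0 = 0" "dotp a (x + y) = dotp a x + dotp a y" "dotp a (c *s x) = c * dotp a x"
  by (simp_all add: dotp_def sum.distrib algebra_simps sum_distrib_left)

lemma dotp_add_left: "dotp (a + b) x = dotp a x + dotp b x"
  by (simp add: dotp_def sum.distrib algebra_simps)

lemma dotp_axis: "dotp a (axis i c) = a $ i * c"
proof -
  have "dotp a (axis i c) = (\<Sum>j\<in>UNIV. if j = i then a $ i * c else 0)"
    unfolding dotp_def by (rule sum.cong) (auto simp: axis_def)
  then show ?thesis by simp
qed

lemma subspace_orth: "vec.subspace (orth A)"
  by (rule vec.subspaceI) (auto simp: orth_def)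

lemma orth_span [simp]: "orth (vec.span A) = orth A"
proof
  show "orth A \<subseteq> orth (vec.span A)"
  proof
    fix x assume x: "x \<in> orth A"
    have "vec.span A \<subseteq> orth {x}"
      using x by (intro vec.span_minimal subspace_orth) (auto simp: orth_def dotp_commute)
    then show "x \<in> orth (vec.span A)" by (auto simp: orth_def dotp_commute)
  qed
qed (auto simp: orth_def vec.span_base)

text \<open>Each further vector of \<open>X\<close> intersects with one more
  \<open>orth {a}\<close>, which has codimension at most one, so the dimension drops by at most
  one.\<close>

lemma dim_Int_orth_ge:
  assumes "finite X" and "vec.subspace V"
  shows "vec.dim V \<le> vec.dim (V \<inter> orth X) + card X"
  using assms(1)
proof induction
  case empty
  then show ?case by (simp add: orth_def)
next
  case (insert a X)
  let ?P = "orth {a}" and ?W = "V \<inter> orth X"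
  have "vec.dim (UNIV :: ('a^'b) set) \<le> vec.dim ?P + 1"
  proof (cases "a = 0")
    case True
    then have "?P = UNIV" by (auto simp: orth_def dotp_def)
    then show ?thesis by simp
  next
    case False
    then obtain i where i: "a $ i \<noteq> 0" by (auto simp: vec_eq_iff)
    have "y \<in> vec.span (insert (axis i 1) ?P)" for y
    proof -
      \<comment> \<open>\<open>c\<close> is chosen so that subtracting \<open>c *s axis i 1\<close>
        from \<open>y\<close> lands in \<open>orth {a}\<close>: a single axis vector completes this
        space.\<close>
      define c where "c = dotp a y / a $ i"
      have "dotp a (y + (- c) *s axis i 1) = 0"
        using i by (simp only: dotp_simps dotp_axis) (simp add: c_def)
      then have "y - c *s axis i 1 \<in> ?P" by (simp add: orth_def)
      then have "(y - c *s axis i 1) + c *s axis i 1 \<in> vec.span (insert (axis i 1) ?P)"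
        by (intro vec.span_add vec.span_scale vec.span_base) auto
      then show ?thesis by simp
    qed
    then have "vec.span (insert (axis i 1) ?P) = UNIV" by auto
    then have "vec.dim (UNIV :: ('a^'b) set) = vec.dim (insert (axis i 1) ?P)"
      by (metis vec.dim_span)
    also have "\<dots> \<le> vec.dim ?P + 1" by (simp add: vec.dim_insert)
    finally show ?thesis .
  qed
  moreover have "vec.dim {x + y |x y. x \<in> ?W \<and> y \<in> ?P} + vec.dim (?W \<inter> ?P)
      = vec.dim ?W + vec.dim ?P"
    using assms(2) by (intro vec.dim_sums_Int vec.subspace_inter subspace_orth)
  moreover have "vec.dim {x + y |x y. x \<in> ?W \<and> y \<in> ?P} \<le> vec.dim (UNIV :: ('a^'b) set)"
    by (rule vec.dim_subset) simp
  moreover have "?W \<inter> ?P = V \<inter> orth (insert a X)" by (auto simp: orth_def)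
  ultimately show ?case using insert by simp
qed

text \<open>Two uses of the previous bound. Cutting the whole space by a basis \<open>B\<close> of
  \<open>A\<close> gives one inequality. Cutting \<open>orth B\<close> by the rest of an extended
  basis leaves only 0, which gives the other.\<close>

lemma dim_orth:
  fixes A :: "('a::field^'n) set"
  shows "vec.dim (orth A) = CARD('n) - vec.dim A"
proof -
  obtain B where B: "B \<subseteq> A" "vec.independent B" "A \<subseteq> vec.span B" "card B = vec.dim A"
    using vec.basis_exists by blast
  define E where "E = vec.extend_basis B"
  have E: "B \<subseteq> E" "vec.independent E" "vec.span E = UNIV"
    unfolding E_def using B(2) vec.extend_basis_superset vec.independent_extend_basis
      vec.span_extend_basis by auto
  have fin: "finite B" "finite E" using B(2) E(2) vec.finiteI_independent by auto
  have cE: "card E = CARD('n)"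
    by (metis E(2,3) vec.dim_span_eq_card_independent vec_dim_card)
  have "vec.span A = vec.span B"
    using B(1,3) vec.span_mono[of B A] vec.span_minimal[of A "vec.span B"] by auto
  then have AB: "orth A = orth B" by (metis orth_span)
  have "x $ i = 0" if "x \<in> orth UNIV" for x :: "'a^'n" and i
    using that dotp_axis[of x i 1] by (simp add: orth_def dotp_commute[of x])
  then have "x = 0" if "x \<in> orth UNIV" for x :: "'a^'n"
    using that by (simp add: vec_eq_iff)
  then have "orth (UNIV :: ('a^'n) set) = {0}" by (auto simp: orth_def)
  then have "orth E = {0}" by (metis E(3) orth_span)
  moreover have "orth B \<inter> orth (E - B) = orth E" using E(1) by (auto simp: orth_def)
  ultimately have "vec.dim (orth B \<inter> orth (E - B)) = 0" by simp
  then have "vec.dim (orth B) \<le> card (E - B)"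
    using dim_Int_orth_ge[of "E - B" "orth B"] fin subspace_orth[of B]
    by (simp del: vec.dim_eq_0)
  moreover have "card (E - B) = CARD('n) - vec.dim A"
    using E(1) fin B(4) cE by (simp add: card_Diff_subset)
  moreover have "CARD('n) \<le> vec.dim (orth B) + card B"
    using dim_Int_orth_ge[of B UNIV] fin
    by (simp only: vec_dim_card vec.subspace_UNIV Int_UNIV_left)
  ultimately show ?thesis using AB B(4) by simp
qed

lemma orth_orth:
  assumes "vec.subspace A"
  shows "orth (orth A) = A"
proof (rule vec.subspace_dim_equal[symmetric, OF assms subspace_orth])
  show "A \<subseteq> orth (orth A)" by (auto simp: orth_def dotp_commute)
  show "vec.dim A \<ge> vec.dim (orth (orth A))"
    using dim_subset_UNIV_cart_gen[of A] by (simp add: dim_orth)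
qed

lemma generator_matrix_orth:
  fixes G :: "'a::field^'n^'k"
  assumes "generator_matrix G C"
  shows "x \<in> orth C \<longleftrightarrow> G *v x = 0"
proof -
  have "orth C = orth (rows G)"
    using assms orth_span[of "rows G"] by (simp add: generator_matrix_def)
  then show ?thesis
    by (auto simp: orth_def rows_def row_def dotp_def matrix_vector_mult_def vec_eq_iff)
qed

text \<open>Row rank equals column rank in the case needed: independent rows give a right inverse.
  This supplies the spanning condition in \<open>rank_system\<close>.\<close>

lemma generator_matrix_span_columns:
  fixes G :: "'a::field^'n^'k"
  assumes G: "generator_matrix G C" and dim: "vec.dim C = CARD('k)"
  shows "vec.span (columns G) = UNIV"
proof -
  have d: "vec.dim (rows G) = CARD('k)"
    using G dim vec.dim_span[of "rows G"] by (simp add: generator_matrix_def)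
  have rows: "rows G = range (\<lambda>i. row i G)" by (auto simp: rows_def)
  have fin: "finite (rows G)" by (simp add: rows)
  have "card (rows G) \<le> CARD('k)" unfolding rows by (rule card_image_le) simp
  moreover have "vec.dim (rows G) \<le> card (rows G)"
    using fin vec.span_superset by (intro vec.dim_le_card) auto
  ultimately have card: "card (rows G) = CARD('k)" using d by simp
  then have ind: "vec.independent (rows G)"
    using vec.card_eq_dim[of "rows G" "rows G"] d fin vec.span_superset by auto
  \<comment> \<open>\<open>rows G\<close> is a set, so independence of it alone would allow repeated
    rows; the count excludes them.\<close>
  have inj: "inj (\<lambda>i. row i G)" using card rows by (intro eq_card_imp_inj_on) auto
  have "c i = 0" if "(\<Sum>i\<in>UNIV. c i *s row i G) = 0" for c and i :: 'k
  proof -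
    define u where "u v = c (inv (\<lambda>i. row i G) v)" for v
    have u: "u (row i G) = c i" for i by (simp add: u_def inv_f_f[OF inj])
    have "(\<Sum>v\<in>rows G. u v *s v) = (\<Sum>i\<in>UNIV. u (row i G) *s row i G)"
      unfolding rows by (rule sum.reindex_cong[OF inj]) auto
    then have "(\<Sum>v\<in>rows G. u v *s v) = 0" using that u by simp
    then have "u (row i G) = 0"
      using vec.independentD[OF ind fin, of u "row i G"] by (auto simp: rows)
    then show ?thesis by (simp add: u)
  qed
  then have "\<exists>B. G ** B = mat 1" unfolding matrix_right_invertible_independent_rows by blast
  then show ?thesis unfolding matrix_right_invertible_span_columns by simp
qed

section \<open>Finite field extensions\<close>

locale finite_extension = field_embedding emb
  for emb :: "'f::{field,finite} \<Rightarrow> 'a::{field,finite}" +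
  fixes q m :: nat
  assumes primepow_base: "primepow q"
    and card_base: "CARD('f) = q"
    and card_ext: "CARD('a) = q ^ m"
begin

lemma q_gt_1: "q > 1"
  using one_less_card_field[where 'f='f] by (simp add: card_base)

lemma emb_0 [simp]: "emb 0 = 0"
  using emb_add[of 0 0] by (simp only: add_0_left) (metis add_cancel_right_left)

lemma emb_minus: "emb (- x) = - emb x"
  using emb_add[of x "- x"] by (simp add: eq_neg_iff_add_eq_0 add.commute)

lemma emb_power: "emb (x ^ i) = emb x ^ i"
  by (induction i) (simp_all add: emb_one emb_mult)

lemma emb_eq_0_iff [simp]: "emb x = 0 \<longleftrightarrow> x = 0"
proof
  assume "emb x = 0"
  then show "x = 0"
    using emb_mult[of x "inverse x"] emb_one by (cases "x = 0") auto
qed simp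

lemma inj_emb: "inj emb"
proof (rule injI)
  fix x y assume "emb x = emb y"
  then have "emb (x + (- y)) = 0" by (simp only: emb_add emb_minus) simp
  then show "x = y" by simp
qed

lemma base_field_power_card: "(x :: 'f) ^ q = x"
proof (cases "x = 0")
  case False
  \<comment> \<open>Multiplication by \<open>x\<close> permutes the nonzero elements, so the factor
    it contributes to their product is 1.\<close>
  have "(\<Prod>y\<in>UNIV-{0}. x * y) = (\<Prod>y\<in>UNIV-{0}. y)"
    by (rule prod.reindex_bij_witness[of _ "\<lambda>y. y / x" "\<lambda>y. x * y"]) (use False in auto)
  then have "x ^ card (UNIV - {0 :: 'f}) * (\<Prod>y\<in>UNIV-{0}. y) = (\<Prod>y\<in>UNIV-{0}. y)"
    by (simp add: prod.distrib)
  moreover have "(\<Prod>y\<in>UNIV-{0 :: 'f}. y) \<noteq> 0" by simp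
  ultimately have "x ^ card (UNIV - {0 :: 'f}) = 1" by (metis mult_cancel_right1 mult_1)
  moreover have "q = Suc (card (UNIV - {0 :: 'f}))"
    using q_gt_1 by (simp add: card_Diff_singleton card_base)
  ultimately show ?thesis by (simp only: power_Suc) simp
qed (use q_gt_1 in \<open>simp add: zero_power\<close>)

text \<open>The \<open>q\<close> elements of the embedded base field are roots of X^q - X, which has
  at most \<open>q\<close> roots, so they are all of them.\<close>

lemma power_card_eq_iff: "x ^ q = x \<longleftrightarrow> x \<in> range emb"
proof
  assume x: "x ^ q = x"
  define p :: "'a poly" where "p = monom 1 q - monom 1 1"
  have q1: "q > 1" by (rule q_gt_1)
  then have "coeff p q = 1" by (simp add: p_def)
  then have p0: "p \<noteq> 0" by auto
  have "degree p \<le> q" unfolding p_def using q1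
    by (intro degree_diff_le degree_monom_le order.trans[OF degree_monom_le]) auto
  then have "card {x. poly p x = 0} \<le> q"
    using card_poly_roots_bound[OF p0] by linarith
  moreover have "range emb \<subseteq> {x. poly p x = 0}"
    by (auto simp: p_def poly_monom base_field_power_card simp flip: emb_power)
  moreover have "card (range emb) = q" by (simp add: card_image inj_emb card_base)
  ultimately have "range emb = {x. poly p x = 0}"
    by (intro card_seteq) auto
  then show "x \<in> range emb" using x by (auto simp: p_def poly_monom)
qed (auto simp: base_field_power_card simp flip: emb_power)

lemma frobenius_sum: "(sum f A :: 'a) ^ q = (\<Sum>i\<in>A. f i ^ q)"
proof -
  obtain p e where p: "prime p" "e > 0" "q = p ^ e"
    using primepow_base by (auto simp: primepow_def)
  \<comment> \<open>Shifting by 1 permutes the field, so the number of its elements is 0 in it.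
    Hence the characteristic is the prime of which \<open>q\<close> is a power.\<close>
  have "(\<Sum>y\<in>UNIV. y + (1 :: 'a)) = (\<Sum>y\<in>UNIV. y)"
    by (rule sum.reindex_bij_witness[of _ "\<lambda>y. y - 1" "\<lambda>y. y + 1"]) auto
  then have "of_nat CARD('a) = (0 :: 'a)" by (simp add: sum.distrib)
  then have "CHAR('a) dvd p ^ (e * m)"
    using card_ext p(3) by (simp only: of_nat_eq_0_iff_char_dvd power_mult)
  moreover have pr: "prime CHAR('a)"
    using prime_CHAR_semidom finite_imp_CHAR_pos[where 'a='a] by simp
  ultimately have "CHAR('a) = p"
    using p(1) by (metis prime_dvd_power primes_dvd_imp_eq)
  then show ?thesis using freshmans_dream_sum'[OF pr] p(3) by metis
qed

lemma finite_vector_space_base: "finite_vector_space (base_scale emb)"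
  unfolding finite_vector_space_def by (rule vector_space_base_scale)

lemma finite_vector_space_base_vec:
  "finite_vector_space (base_vscale emb :: 'f \<Rightarrow> 'a^'n \<Rightarrow> 'a^'n)"
  unfolding finite_vector_space_def by (rule vector_space_base_vscale)

sublocale base: finite_vector_space "base_scale emb"
  by (rule finite_vector_space_base)

lemma dim_base_UNIV: "base.dim UNIV = m"
  using base.card_subspace[of UNIV] card_ext q_gt_1 by (simp add: card_base)

section \<open>Rational points and Galois descent\<close>

text \<open>The copy of F_q^n inside the vectors over the extension, that is, the fixed points of
  the coordinatewise Frobenius map.\<close>

definition rational :: "('a^'n) set" where
  "rational = {v. \<forall>i. v $ i \<in> range emb}"

lemma rational_power: "v \<in> rational \<Longrightarrow> v $ i ^ q = v $ i"
  by (simp add: rational_def power_card_eq_iff)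

text \<open>Frobenius is additive and fixes the entries of \<open>X\<close>, so it commutes with
  pairing against \<open>X\<close>. This is the source of all Galois closed subspaces constructed
  below.\<close>

lemma galois_closed_orth:
  assumes "X \<subseteq> rational"
  shows "galois_closed q (orth X)"
  unfolding galois_closed_def
proof (intro conjI ballI subspace_orth)
  fix v assume v: "v \<in> orth X"
  have "dotp a (\<chi> i. v $ i ^ q) = dotp a v ^ q" if "a \<in> X" for a
  proof -
    have "a $ i ^ q = a $ i" for i
      using that assms by (auto intro: rational_power)
    then show ?thesis by (simp add: dotp_def frobenius_sum power_mult_distrib)
  qed
  then show "(\<chi> i. v $ i ^ q) \<in> orth X"
    using v q_gt_1 by (simp add: orth_def)
qed

text \<open>A vector of minimal support, scaled to have an entry 1, is fixed by Frobenius: otherwise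
  subtracting its conjugate would shrink the support.\<close>

lemma galois_descent:
  fixes A :: "('a^'n) set"
  assumes "galois_closed q A"
  shows "vec.span (A \<inter> rational) = A"
proof
  have sub: "vec.subspace A" and fr: "v \<in> A \<Longrightarrow> (\<chi> i. v $ i ^ q) \<in> A" for v
    using assms by (auto simp: galois_closed_def)
  show "vec.span (A \<inter> rational) \<subseteq> A"
    using sub by (intro vec.span_minimal) auto
  define supp where "supp v = {i. v $ i \<noteq> 0}" for v :: "'a^'n"
  have "v \<in> vec.span (A \<inter> rational)" if "v \<in> A" for v
    using that
  proof (induction "card (supp v)" arbitrary: v rule: less_induct)
    case less
    show ?case
    proof (cases "v = 0")
      case True
      then show ?thesis by (simp add: vec.span_zero)
    next
      case False
      let ?P = "\<lambda>w. w \<in> A \<and> w \<noteq> 0 \<and> supp w \<subseteq> supp v"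
      obtain w where w: "?P w" and min: "\<And>u. ?P u \<Longrightarrow> card (supp w) \<le> card (supp u)"
      proof -
        have "?P v" using less.prems False by simp
        from ex_has_least_nat[of ?P, OF this, of "\<lambda>w. card (supp w)"] show ?thesis
          using that by auto
      qed
      obtain i where i: "w $ i \<noteq> 0" using w by (auto simp: vec_eq_iff)
      define r where "r = inverse (w $ i) *s w"
      have r: "r \<in> A" "r $ i = 1"
        using i w vec.subspace_scale[OF sub] by (auto simp: r_def)
      have r0: "r $ j = 0 \<longleftrightarrow> w $ j = 0" for j using i by (simp add: r_def)
      define u where "u = (\<chi> i. r $ i ^ q) - r"
      have "u \<in> A" unfolding u_def by (intro vec.subspace_diff[OF sub] fr r(1))
      moreover have "supp u \<subseteq> supp w - {i}"
      proof
        fix j assume "j \<in> supp u"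
        then have j: "r $ j ^ q \<noteq> r $ j" by (simp add: supp_def u_def)
        then have "r $ j \<noteq> 0" using q_gt_1 by (auto simp: zero_power)
        moreover have "j \<noteq> i" using j r(2) by auto
        ultimately show "j \<in> supp w - {i}" by (simp add: supp_def r0)
      qed
      moreover have "i \<in> supp w" using i by (simp add: supp_def)
      ultimately have "supp u \<subset> supp w" by blast
      then have "card (supp u) < card (supp w)" and "supp u \<subseteq> supp v"
        using w by (auto intro!: psubset_card_mono)
      then have "u = 0" using min[of u] \<open>u \<in> A\<close> by auto
      then have "r $ j ^ q = r $ j" for j by (simp add: u_def vec_eq_iff)
      then have "r \<in> rational" by (simp add: rational_def power_card_eq_iff)
      then have rs: "r \<in> vec.span (A \<inter> rational)" using r(1) by (simp add: vec.span_base)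
      \<comment> \<open>Clearing entry \<open>i\<close> of \<open>v\<close> by the rational vector
        \<open>r\<close> shrinks the support strictly, so the induction hypothesis applies to
        \<open>t\<close>.\<close>
      define t where "t = v - (v $ i) *s r"
      have "t \<in> A" unfolding t_def
        using less.prems r(1) sub by (intro vec.subspace_diff vec.subspace_scale) auto
      moreover have "supp t \<subseteq> supp v - {i}"
      proof
        fix j assume "j \<in> supp t"
        then have j: "v $ j - v $ i * r $ j \<noteq> 0" by (simp add: supp_def t_def)
        then have "j \<noteq> i" using r(2) by auto
        moreover have "j \<in> supp v"
        proof (rule ccontr)
          assume "j \<notin> supp v"
          then have "v $ j = 0" "w $ j = 0" using w by (auto simp: supp_def)
          then show False using j r0 by simp
        qed
        ultimately show "j \<in> supp v - {i}" by simp
      qed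
      then have "supp t \<subset> supp v" using \<open>i \<in> supp w\<close> w by blast
      then have "card (supp t) < card (supp v)" by (intro psubset_card_mono) auto
      ultimately have "t \<in> vec.span (A \<inter> rational)" using less.hyps by blast
      then have "t + (v $ i) *s r \<in> vec.span (A \<inter> rational)"
        using rs by (intro vec.span_add vec.span_scale)
      then show ?thesis by (simp add: t_def)
    qed
  qed
  then show "A \<subseteq> vec.span (A \<inter> rational)" by blast
qed

lemma galois_closed_basis:
  assumes "galois_closed q A"
  obtains X where "X \<subseteq> A \<inter> rational" "vec.independent X" "vec.span X = A" "card X = vec.dim A"
proof -
  obtain X where X: "X \<subseteq> A \<inter> rational" "vec.independent X" "A \<inter> rational \<subseteq> vec.span X"
    "card X = vec.dim (A \<inter> rational)"
    using vec.basis_exists by blast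
  have "vec.span X = vec.span (A \<inter> rational)"
    using X(1,3) vec.span_mono[of X] vec.span_minimal[of _ "vec.span X"] by blast
  then show ?thesis
    using that[of X] X galois_descent[OF assms] by (metis vec.dim_span)
qed

text \<open>By descent for the whole space, rational vectors span it, so \<open>X\<close> extends to
  a rational basis. A subset of the prescribed size \<open>w\<close> is then taken.\<close>

lemma rational_extend:
  fixes X :: "('a^'n) set"
  assumes "X \<subseteq> rational" and "vec.independent X" and "card X \<le> w" and "w \<le> CARD('n)"
  obtains Y where "X \<subseteq> Y" "Y \<subseteq> rational" "vec.independent Y" "card Y = w"
proof -
  obtain B where B: "X \<subseteq> B" "B \<subseteq> rational" "vec.independent B" "rational \<subseteq> vec.span B"
    using vec.maximal_independent_subset_extend[OF assms(1,2)] by blast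
  have "galois_closed q (UNIV :: ('a^'n) set)" by (simp add: galois_closed_def)
  then have "vec.span rational = (UNIV :: ('a^'n) set)" using galois_descent by fastforce
  then have "vec.span B = UNIV" using B(4) vec.span_minimal[of rational "vec.span B"] by auto
  then have "card B = CARD('n)"
    by (metis B(3) vec.dim_span_eq_card_independent vec_dim_card)
  then obtain Y where Y: "X \<subseteq> Y" "Y \<subseteq> B" "card Y = w"
    using exists_subset_between[of X w B] assms B(1) vec.finiteI_independent[OF B(3)] by auto
  have "Y \<subseteq> rational" using Y(2) B(2) by (rule subset_trans)
  moreover have "vec.independent Y" using B(3) Y(2) by (rule vec.independent_mono)
  ultimately show ?thesis using that Y by simp
qed

lemma sum_emb_in_rational:
  assumes "X \<subseteq> rational"
  shows "(\<Sum>b\<in>X. emb (c b) *s b) \<in> rational"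
proof -
  have "(\<Sum>b\<in>X. emb (c b) * b $ i) ^ q = (\<Sum>b\<in>X. emb (c b) * b $ i)" for i
  proof -
    have "(emb (c b) * b $ i) ^ q = emb (c b) * b $ i" if "b \<in> X" for b
      using rational_power[of b i] that assms
      by (auto simp: power_mult_distrib power_card_eq_iff[THEN iffD2])
    then show ?thesis by (simp add: frobenius_sum)
  qed
  then show ?thesis by (simp add: rational_def power_card_eq_iff[symmetric] sum_component)
qed

text \<open>Frobenius fixes a rational vector and the members of \<open>X\<close>, so by uniqueness
  it fixes the coefficients. These therefore lie in the base field, and there are \<open>q\<close>
  choices for each.\<close>

lemma card_rational_Int_span:
  fixes X :: "('a^'n) set"
  assumes "X \<subseteq> rational" and ind: "vec.independent X"
  shows "card (rational \<inter> vec.span X) = q ^ card X"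
proof -
  define f where "f c = (\<Sum>b\<in>X. emb (c b) *s b)" for c
  have uniq: "g b = h b" if "(\<Sum>b\<in>X. g b *s b) = (\<Sum>b\<in>X. h b *s b)" "b \<in> X" for g h b
  proof -
    have "(\<Sum>b\<in>X. (g b - h b) *s b) = 0"
      using that(1) by (simp add: vec.scale_left_diff_distrib sum_subtractf)
    then show ?thesis
      using vec.independentD[OF ind, of X "\<lambda>b. g b - h b" b] that(2) by simp
  qed
  have "inj_on f (X \<rightarrow>\<^sub>E UNIV)"
  proof (rule inj_onI)
    fix u v assume uv: "u \<in> X \<rightarrow>\<^sub>E UNIV" "v \<in> X \<rightarrow>\<^sub>E UNIV" "f u = f v"
    have "emb (u b) = emb (v b)" if "b \<in> X" for b
      using uniq[OF uv(3)[unfolded f_def] that] .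
    then have "u b = v b" if "b \<in> X" for b
      using inj_emb that by (auto dest: injD)
    then show "u = v" using uv(1,2) by (intro PiE_ext) auto
  qed
  then have "card (f ` (X \<rightarrow>\<^sub>E UNIV)) = q ^ card X"
    by (simp add: card_image card_PiE card_base)
  moreover have "f ` (X \<rightarrow>\<^sub>E UNIV) = rational \<inter> vec.span X"
  proof
    show "f ` (X \<rightarrow>\<^sub>E UNIV) \<subseteq> rational \<inter> vec.span X"
      unfolding f_def using sum_emb_in_rational[OF assms(1)] vec.span_superset[of X]
      by (blast intro: vec.span_sum vec.span_scale)
    show "rational \<inter> vec.span X \<subseteq> f ` (X \<rightarrow>\<^sub>E UNIV)"
    proof
      fix v assume v: "v \<in> rational \<inter> vec.span X"
      then obtain u where u: "v = (\<Sum>b\<in>X. u b *s b)" by (auto simp: vec.span_finite)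
      have "v $ i = (\<Sum>b\<in>X. u b ^ q * b $ i)" for i
      proof -
        have "v $ i = (v $ i) ^ q" using v by (simp add: rational_power)
        also have "\<dots> = (\<Sum>b\<in>X. u b ^ q * b $ i)"
        proof -
          have "b $ i ^ q = b $ i" if "b \<in> X" for b
            using that assms(1) by (auto intro: rational_power)
          then show ?thesis by (simp add: u sum_component frobenius_sum power_mult_distrib)
        qed
        finally show ?thesis .
      qed
      then have "(\<Sum>b\<in>X. u b *s b) = (\<Sum>b\<in>X. u b ^ q *s b)"
        by (simp add: vec_eq_iff sum_component u[symmetric])
      then have "u b \<in> range emb" if "b \<in> X" for b
        using uniq[of u "\<lambda>b. u b ^ q" b] that power_card_eq_iff by metis
      then have "\<forall>b\<in>X. \<exists>c. u b = emb c" by blast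
      then obtain c where c: "\<And>b. b \<in> X \<Longrightarrow> u b = emb (c b)" by metis
      then have "v = f (restrict c X)" unfolding u f_def by (intro sum.cong) auto
      then show "v \<in> f ` (X \<rightarrow>\<^sub>E UNIV)" by auto
    qed
  qed
  ultimately show ?thesis by simp
qed

lemma card_rational: "card (rational :: ('a^'n) set) = q ^ CARD('n)"
proof -
  obtain X :: "('a^'n) set" where X: "X \<subseteq> rational" "vec.independent X" "card X = CARD('n)"
    using rational_extend[of "{}" "CARD('n)"] vec.independent_empty by auto
  then have "vec.span X = UNIV"
    by (metis top_greatest vec.card_eq_dim vec.finiteI_independent vec_dim_card subset_antisym)
  then show ?thesis using card_rational_Int_span[OF X(1,2)] X(3) by simp
qed

section \<open>Rank weight\<close>

lemma rank_weight_eq_dim: "rank_weight emb v = base.dim (range (($) v))"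
proof -
  have "{v $ i | i. i \<in> UNIV} = range (($) v)" by auto
  then show ?thesis by (simp add: rank_weight_def)
qed

lemma rank_weight_le_dim:
  assumes "\<And>i. v $ i \<in> K"
  shows "rank_weight emb v \<le> base.dim K"
  unfolding rank_weight_eq_dim using assms by (intro base.dim_subset) auto

lemma rank_weight_le_degree: "rank_weight emb v \<le> m"
  using rank_weight_le_dim[of v UNIV] dim_base_UNIV by simp

lemma rank_weight_pos: "v \<noteq> 0 \<Longrightarrow> 0 < rank_weight emb v"
proof -
  assume "v \<noteq> 0"
  then have "\<not> range (($) v) \<subseteq> {0}" by (auto simp: vec_eq_iff)
  then show ?thesis unfolding rank_weight_eq_dim
    using base.dim_eq_0[of "range (($) v)"] by (simp del: base.dim_eq_0)
qed

text \<open>The entries of a combination of rational vectors lie in the base field span of its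
  coefficients. With the converse below, rank weight is the least number of rational vectors whose
  span contains \<open>x\<close>.\<close>

lemma rank_weight_le_card:
  fixes X :: "('a^'n) set"
  assumes "X \<subseteq> rational" and "x \<in> vec.span X"
  shows "rank_weight emb x \<le> card X"
proof -
  obtain u where u: "x = (\<Sum>b\<in>X. u b *s b)" using assms(2) by (auto simp: vec.span_finite)
  have "x $ i \<in> base.span (u ` X)" for i
  proof -
    have "u b * b $ i \<in> base.span (u ` X)" if "b \<in> X" for b
    proof -
      have "b $ i \<in> range emb" using assms(1) that by (auto simp only: rational_def)
      then obtain c where "b $ i = emb c" by blast
      then have "u b * b $ i = base_scale emb c (u b)" by (simp add: base_scale_def)
      then show ?thesis using that by (simp add: base.span_scale base.span_base)
    qed
    then show ?thesis by (simp add: u sum_component base.span_sum)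
  qed
  then have "rank_weight emb x \<le> base.dim (base.span (u ` X))" by (rule rank_weight_le_dim)
  also have "\<dots> \<le> card (u ` X)" by (simp add: base.dim_le_card base.span_superset)
  also have "\<dots> \<le> card X" by (simp add: card_image_le)
  finally show ?thesis .
qed

lemma rank_weight_le_obtains:
  fixes x :: "'a^'n"
  assumes "rank_weight emb x \<le> w" and "w \<le> CARD('n)"
  obtains X where "X \<subseteq> rational" "vec.independent X" "card X = w" "x \<in> vec.span X"
proof -
  obtain B where B: "base.span B = base.span (range (($) x))" "card B = rank_weight emb x"
    using base.basis_subspace_exists[OF base.subspace_span, of "range (($) x)"]
    by (metis base.dim_span rank_weight_eq_dim)
  have "\<exists>c. x $ i = (\<Sum>b\<in>B. emb (c b) * b)" for i
  proof -
    have "x $ i \<in> base.span B" unfolding B(1) by (rule base.span_base) simp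
    then show ?thesis by (auto simp: base.span_finite base_scale_def)
  qed
  then obtain c where c: "\<And>i. x $ i = (\<Sum>b\<in>B. emb (c i b) * b)" by metis
  \<comment> \<open>\<open>l b\<close> collects the coordinates at \<open>b\<close> of all entries
    of \<open>x\<close>, so it is rational and \<open>x\<close> is the sum of the
    \<open>b *s l b\<close>.\<close>
  define l where "l b = (\<chi> i. emb (c i b))" for b
  have "x = (\<Sum>b\<in>B. b *s l b)"
    by (simp add: vec_eq_iff c sum_component l_def mult.commute)
  then have x: "x \<in> vec.span (l ` B)"
    by (simp add: vec.span_sum vec.span_scale vec.span_base)
  have lr: "l ` B \<subseteq> rational" by (auto simp: rational_def l_def)
  obtain Z where Z: "Z \<subseteq> l ` B" "vec.independent Z" "l ` B \<subseteq> vec.span Z"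
    using vec.maximal_independent_subset by blast
  have "card Z \<le> card (l ` B)" using Z(1) by (simp add: card_mono)
  also have "\<dots> \<le> card B" by (simp add: card_image_le)
  finally have "card Z \<le> w" using B(2) assms(1) by simp
  then obtain X where X: "Z \<subseteq> X" "X \<subseteq> rational" "vec.independent X" "card X = w"
    using rational_extend[of Z w] Z(1,2) lr assms(2) by (metis subset_trans)
  have "vec.span (l ` B) \<subseteq> vec.span X"
    using Z(3) vec.span_mono[OF X(1)] by (intro vec.span_minimal) auto
  then show ?thesis using that X x by blast
qed

section \<open>The Singleton bound and its equality case\<close>

lemma card_box: "card {v :: 'a^'n. \<forall>i. v $ i \<in> K} = card K ^ CARD('n)"
proof -
  have "bij_betw vec_lambda (UNIV \<rightarrow>\<^sub>E K) {v :: 'a^'n. \<forall>i. v $ i \<in> K}"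
    by (rule bij_betw_byWitness[where f' = vec_nth]) auto
  then show ?thesis by (simp add: bij_betw_same_card[symmetric] card_PiE)
qed

lemma card_subspace_vec:
  fixes V :: "('a^'n) set"
  assumes "vec.subspace V"
  shows "card V = q ^ (m * vec.dim V)"
proof -
  interpret F: finite_vector_space "(*s) :: 'a \<Rightarrow> 'a^'n \<Rightarrow> 'a^'n" ..
  show ?thesis using F.card_subspace[OF assms] by (simp add: card_ext power_mult)
qed

text \<open>Two representations of one vector would differ by a codeword with all entries in
  \<open>K\<close>, whose rank weight is below \<open>d\<close>.\<close>

lemma inj_on_code_plus_box:
  fixes V :: "('a^'n) set"
  assumes "vec.subspace V" and dist: "\<And>x. x \<in> V \<Longrightarrow> x \<noteq> 0 \<Longrightarrow> d \<le> rank_weight emb x"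
    and "base.subspace K" and "base.dim K < d"
  shows "inj_on (\<lambda>(x, y). x + y) (V \<times> {v. \<forall>i. v $ i \<in> K})"
proof (rule inj_onI, clarsimp)
  fix x y x' y' :: "'a^'n"
  assume x: "x \<in> V" "x' \<in> V" and y: "\<forall>i. y $ i \<in> K" "\<forall>i. y' $ i \<in> K"
    and eq: "x + y = x' + y'"
  have "x - x' = y' - y" using eq by (simp add: algebra_simps)
  moreover have "(y' - y) $ i \<in> K" for i using y assms(3) by (simp add: base.subspace_diff)
  ultimately have "rank_weight emb (x - x') < d"
    using rank_weight_le_dim[of "x - x'" K] assms(4) by (metis le_less_trans)
  moreover have "x - x' \<in> V" using x assms(1) by (simp add: vec.subspace_diff)
  ultimately show "x = x' \<and> y = y'" using dist[of "x - x'"] eq by fastforce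
qed

text \<open>A packing argument: the code times the vectors over a space \<open>K\<close> of
  dimension \<open>d - 1\<close> embeds into the whole space. The bound compares exponents of
  \<open>q\<close>; \<open>d \<le> m\<close> leaves room for \<open>K\<close>.\<close>

lemma singleton_bound:
  fixes V :: "('a^'n) set"
  assumes V: "vec.subspace V" and dist: "\<And>x. x \<in> V \<Longrightarrow> x \<noteq> 0 \<Longrightarrow> d \<le> rank_weight emb x"
    and d: "1 \<le> d" "d \<le> m"
  shows "m * vec.dim V + CARD('n) * (d - 1) \<le> CARD('n) * m"
proof -
  have "d - 1 \<le> base.dim UNIV" using d dim_base_UNIV by simp
  then obtain K where K: "base.subspace K" "base.dim K = d - 1"
    using base.choose_subspace_of_subspace[of "d - 1" UNIV] by metis
  let ?S = "V \<times> {v :: 'a^'n. \<forall>i. v $ i \<in> K}"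
  have "card ?S \<le> card (UNIV :: ('a^'n) set)"
    using inj_on_code_plus_box[OF V dist K(1)] K(2) d by (intro card_inj_on_le) auto
  moreover have "card ?S = q ^ (m * vec.dim V + CARD('n) * (d - 1))"
    using base.card_subspace[OF K(1)] K(2)
    by (simp add: card_cartesian_product card_box card_subspace_vec[OF V] card_base power_add
        mult.commute flip: power_mult)
  moreover have "card (UNIV :: ('a^'n) set) = q ^ (CARD('n) * m)"
    by (simp add: card_ext mult.commute flip: power_mult)
  ultimately show ?thesis using q_gt_1 by simp
qed

text \<open>For nonzero \<open>s\<close>, the condition \<open>s * y \<in> H\<close> defines the
  hyperplane \<open>H\<close> divided by \<open>s\<close>, so each element of \<open>T\<close> costs
  at most one dimension. This provides the space \<open>K\<close> in the duality argument.\<close>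

lemma dim_base_quotient_hyperplane:
  assumes H: "base.subspace H" "base.dim H + 1 = m" and "finite T"
  shows "base.subspace {y. \<forall>s\<in>T. s * y \<in> H}"
    and "m \<le> base.dim {y. \<forall>s\<in>T. s * y \<in> H} + card T"
proof -
  have sub: "base.subspace {y. \<forall>s\<in>T. s * y \<in> H}" for T
  proof (rule base.subspaceI)
    fix c y assume "y \<in> {y. \<forall>s\<in>T. s * y \<in> H}"
    moreover have "s * base_scale emb c y = base_scale emb c (s * y)" for s
      by (simp add: base_scale_def)
    ultimately show "base_scale emb c y \<in> {y. \<forall>s\<in>T. s * y \<in> H}"
      using base.subspace_scale[OF H(1)] by simp
  qed (use base.subspace_0[OF H(1)] base.subspace_add[OF H(1)] in \<open>auto simp: distrib_left\<close>)
  show "base.subspace {y. \<forall>s\<in>T. s * y \<in> H}" by (rule sub)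
  show "m \<le> base.dim {y. \<forall>s\<in>T. s * y \<in> H} + card T"
    using assms(3)
  proof induction
    case empty
    then show ?case by (simp add: dim_base_UNIV del: base.dim_UNIV)
  next
    case (insert t T)
    let ?A = "{y. \<forall>s\<in>T. s * y \<in> H}" and ?P = "{y. t * y \<in> H}"
    have P: "base.subspace ?P" using sub[of "{t}"] by simp
    have "m \<le> base.dim ?P + 1"
    proof (cases "t = 0")
      case True
      then show ?thesis
        using base.subspace_0[OF H(1)] by (simp add: dim_base_UNIV del: base.dim_UNIV)
    next
      case False
      then have "bij_betw (\<lambda>y. t * y) ?P H"
        by (intro bij_betw_byWitness[where f' = "\<lambda>y. y / t"]) auto
      then have "card ?P = card H" by (rule bij_betw_same_card)
      then have "base.dim ?P = base.dim H"
        using base.card_subspace[OF P] base.card_subspace[OF H(1)] q_gt_1 by (simp add: card_base)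
      then show ?thesis using H(2) by simp
    qed
    moreover have "base.dim {x + y |x y. x \<in> ?A \<and> y \<in> ?P} + base.dim (?A \<inter> ?P)
        = base.dim ?A + base.dim ?P"
      by (rule base.dim_sums_Int[OF sub P])
    moreover have "base.dim {x + y |x y. x \<in> ?A \<and> y \<in> ?P} \<le> m"
      by (rule order.trans[OF base.dim_subset[OF subset_UNIV]])
        (simp add: dim_base_UNIV del: base.dim_UNIV)
    moreover have "?A \<inter> ?P = {y. \<forall>s\<in>insert t T. s * y \<in> H}" by auto
    ultimately show ?case using insert by simp
  qed
qed

text \<open>Delsarte duality for codes meeting the Singleton bound. Suppose the entries of a dual word \<open>c\<close>
  lie in a small space spanned by \<open>T\<close>. Choose \<open>K\<close> so that \<open>T K\<close> lies in a hyperplane \<open>H\<close> over the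
  base field. By the equality, \<open>V\<close> and the vectors over \<open>K\<close> together span the whole space, so \<open>c\<close>
  pairs every vector into \<open>H\<close>.\<close>

lemma singleton_equality_dual:
  fixes V :: "('a^'n) set"
  assumes V: "vec.subspace V" and dist: "\<And>x. x \<in> V \<Longrightarrow> x \<noteq> 0 \<Longrightarrow> d \<le> rank_weight emb x"
    and d: "1 \<le> d" "d \<le> m"
    and eq: "m * vec.dim V + CARD('n) * (d - 1) = CARD('n) * m"
    and c: "c \<in> orth V" "c \<noteq> 0"
  shows "m + 2 \<le> rank_weight emb c + d"
proof (rule ccontr)
  assume neg: "\<not> m + 2 \<le> rank_weight emb c + d"
  obtain T where T: "base.span T = base.span (range (($) c))" "card T = rank_weight emb c"
    using base.basis_subspace_exists[OF base.subspace_span, of "range (($) c)"]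
    by (metis base.dim_span rank_weight_eq_dim)
  have "m - 1 \<le> base.dim UNIV" using dim_base_UNIV by simp
  then obtain H where "base.subspace H" "base.dim H = m - 1"
    using base.choose_subspace_of_subspace[of "m - 1" UNIV] by metis
  then have H: "base.subspace H" "base.dim H + 1 = m" using d by auto
  \<comment> \<open>The assumed failure says that \<open>T\<close> has at most
    \<open>m + 1 - d\<close> elements, so at least \<open>d - 1\<close> dimensions survive.\<close>
  have "d - 1 \<le> base.dim {y. \<forall>s\<in>T. s * y \<in> H}"
    using dim_base_quotient_hyperplane(2)[OF H, of T] neg T(2) by simp
  then obtain K where K: "base.subspace K" "K \<subseteq> base.span {y. \<forall>s\<in>T. s * y \<in> H}"
    "base.dim K = d - 1"
    by (rule base.choose_subspace_of_subspace)
  have "base.span {y. \<forall>s\<in>T. s * y \<in> H} = {y. \<forall>s\<in>T. s * y \<in> H}"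
    unfolding base.span_eq_iff by (rule dim_base_quotient_hyperplane(1)[OF H]) simp
  with K have K: "base.subspace K" "base.dim K = d - 1" "K \<subseteq> {y. \<forall>s\<in>T. s * y \<in> H}"
    by simp_all
  let ?f = "\<lambda>(x, y). x + y :: 'a^'n"
  let ?S = "V \<times> {v :: 'a^'n. \<forall>i. v $ i \<in> K}"
  have "card (?f ` ?S) = card ?S"
    using inj_on_code_plus_box[OF V dist K(1)] K(2) d by (intro card_image) auto
  also have "card ?S = q ^ (m * vec.dim V + CARD('n) * (d - 1))"
    using base.card_subspace[OF K(1)] K(2)
    by (simp add: card_cartesian_product card_box card_subspace_vec[OF V] card_base power_add
        mult.commute flip: power_mult)
  also have "\<dots> = card (UNIV :: ('a^'n) set)"
    unfolding eq by (simp add: card_ext mult.commute flip: power_mult)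
  finally have full: "?f ` ?S = UNIV" by (intro card_subset_eq) auto
  have cK: "c $ i * z \<in> H" if "z \<in> K" for i z
  proof -
    have "base.span T \<subseteq> {s. s * z \<in> H}"
    proof (rule base.span_minimal)
      show "T \<subseteq> {s. s * z \<in> H}" using K(3) that by auto
      show "base.subspace {s. s * z \<in> H}"
        using dim_base_quotient_hyperplane(1)[OF H, of "{z}"] by (simp add: mult.commute)
    qed
    moreover have "c $ i \<in> base.span T" unfolding T(1) by (rule base.span_base) simp
    ultimately show ?thesis by auto
  qed
  have pair: "dotp c v \<in> H" for v
  proof -
    have "v \<in> ?f ` ?S" unfolding full by simp
    then obtain x y where xy: "v = x + y" "x \<in> V" "\<forall>i. y $ i \<in> K" by auto
    have "dotp c x = 0" using c(1) xy(2) by (simp add: orth_def dotp_commute[of c])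
    moreover have "dotp c y \<in> H"
      unfolding dotp_def using cK xy(3) by (intro base.subspace_sum[OF H(1)]) auto
    ultimately show ?thesis by (simp add: xy(1))
  qed
  obtain i where i: "c $ i \<noteq> 0" using c(2) by (auto simp: vec_eq_iff)
  \<comment> \<open>At a nonzero entry of \<open>c\<close>, multiples of the axis vector make the
    pairing take every value, which a proper hyperplane cannot contain.\<close>
  have "z \<in> H" for z
    using pair[of "axis i (z / c $ i)"] i by (simp add: dotp_axis)
  then have "H = UNIV" by auto
  then show False using H(2) dim_base_UNIV by simp
qed

end

section \<open>Near MRD codes and the dual distance\<close>

text \<open>With \<open>j = k - 2\<close>, \<open>r = n - k - 1\<close> and
  \<open>t = n - m - 2\<close>, the last two hypotheses are the Singleton bounds for the dual and
  for the code. They reduce to \<open>(t + 2) * (j + 1) \<le> m\<close> and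
  \<open>m * (t + 1) + (t + 2) * t \<le> (t + 2) * (j + 1)\<close>; chaining them forces
  \<open>t = 0\<close>, and then both are equalities.\<close>

lemma singleton_pair_arith:
  fixes j m r t :: nat
  assumes rr: "m + t = j + r + 1" and "j + 2 \<le> m"
    and "m * Suc r + (m + t + 2) * (j + 1) \<le> (m + t + 2) * m"
    and "m * (j + 2) + (m + t + 2) * r \<le> (m + t + 2) * m"
  shows "t = 0 \<and> m = 2 * j + 2"
proof -
  have "m * (m + t) = m * (j + r + 1)" by (simp only: rr)
  then have a: "(t + 2) * (j + 1) \<le> m" using assms(3) by (simp add: algebra_simps)
  have "(m + t + 2) * (m + t) = (m + t + 2) * (j + r + 1)" by (simp only: rr)
  then have b: "m * (t + 1) + (t + 2) * t \<le> (t + 2) * (j + 1)"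
    using assms(4) by (simp add: algebra_simps)
  have "m * (t + 1) + (t + 2) * t \<le> m" using a b by simp
  then have "t = 0" by (cases t) auto
  then show ?thesis using a b by simp
qed

context finite_extension
begin

text \<open>A dual word \<open>x\<close> of weight below \<open>k\<close> lies in the span of
  \<open>k - 1\<close> rational vectors \<open>X\<close>. Then \<open>orth X\<close> is Galois
  closed of dimension \<open>n - k + 1\<close>, and both it and \<open>C\<close> lie in the
  hyperplane \<open>orth {x}\<close>. So they meet in dimension at least 2, against the second
  weight.\<close>

lemma dual_distance_of_second_weight:
  fixes C :: "('a^'n) set"
  assumes C: "vec.subspace C" and k: "2 \<le> vec.dim C"
    and second: "\<And>A. galois_closed q A \<Longrightarrow> 2 \<le> vec.dim (A \<inter> C) \<Longrightarrow>
      CARD('n) - vec.dim C + 2 \<le> vec.dim A"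
    and x: "x \<in> orth C" "x \<noteq> 0"
  shows "vec.dim C \<le> rank_weight emb x"
proof (rule ccontr)
  let ?n = "CARD('n)" and ?k = "vec.dim C"
  assume "\<not> ?k \<le> rank_weight emb x"
  then have w: "rank_weight emb x \<le> ?k - 1" by simp
  have kn: "?k \<le> ?n" by (rule dim_subset_UNIV_cart_gen)
  obtain X where X: "X \<subseteq> rational" "vec.independent X" "card X = ?k - 1" "x \<in> vec.span X"
    by (rule rank_weight_le_obtains[OF w]) (use kn in simp)
  let ?A = "orth X"
  have dA: "vec.dim ?A = ?n - (?k - 1)"
    using X(2,3) vec.dim_eq_card_independent[OF X(2)] by (simp add: dim_orth)
  have "x \<in> orth (orth (vec.span X))" using X(4) by (simp add: orth_orth del: orth_span)
  then have xA: "dotp a x = 0" if "a \<in> ?A" for a using that by (simp add: orth_def[of "orth X"])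
  then have "{a + c |a c. a \<in> ?A \<and> c \<in> C} \<subseteq> orth {x}"
  proof clarify
    fix a c assume "a \<in> ?A" "c \<in> C"
    then have "dotp a x = 0" "dotp c x = 0" using xA x(1) by (auto simp: orth_def[of C])
    then show "a + c \<in> orth {x}" by (simp add: orth_def dotp_commute[of x] dotp_add_left)
  qed
  then have "vec.dim {a + c |a c. a \<in> ?A \<and> c \<in> C} \<le> vec.dim (orth {x})"
    by (rule vec.dim_subset)
  also have "vec.dim (orth {x}) = ?n - 1" using x(2) by (simp add: dim_orth)
  finally have "vec.dim {a + c |a c. a \<in> ?A \<and> c \<in> C} \<le> ?n - 1" .
  moreover have "vec.dim {a + c |a c. a \<in> ?A \<and> c \<in> C} + vec.dim (?A \<inter> C)
      = vec.dim ?A + ?k"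
    by (rule vec.dim_sums_Int[OF subspace_orth C])
  ultimately have "2 \<le> vec.dim (?A \<inter> C)" using dA k kn by simp
  then have "?n - ?k + 2 \<le> vec.dim ?A"
    using second galois_closed_orth[OF X(1)] by blast
  then show False using dA k kn by simp
qed

text \<open>The value is attained by the complement of \<open>k - s\<close> rational vectors. A
  smaller Galois closed \<open>B\<close> would have at least \<open>k - s + 1\<close> independent
  rational vectors in \<open>orth B\<close>; their span then meets the complement of
  \<open>B + C\<close> in a dual word that is too light.\<close>

lemma gen_rank_weight_of_dual_distance:
  fixes C :: "('a^'n) set"
  assumes C: "vec.subspace C"
    and dual: "\<And>x. x \<in> orth C \<Longrightarrow> x \<noteq> 0 \<Longrightarrow> vec.dim C \<le> rank_weight emb x"
    and s: "2 \<le> s" "s \<le> vec.dim C"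
  shows "gen_rank_weight q s C = CARD('n) - vec.dim C + s"
  unfolding gen_rank_weight_def
proof (rule Least_equality)
  let ?n = "CARD('n)" and ?k = "vec.dim C"
  have kn: "?k \<le> ?n" by (rule dim_subset_UNIV_cart_gen)
  have "?k - s \<le> ?n" using kn by simp
  then obtain X :: "('a^'n) set" where X: "X \<subseteq> rational" "vec.independent X" "card X = ?k - s"
    using rational_extend[of "{} :: ('a^'n) set" "?k - s"]
      vec.independent_empty[where 'a='a and 'b='n] by auto
  have "vec.dim C \<le> vec.dim (C \<inter> orth X) + card X"
    using dim_Int_orth_ge[of X C] C by simp
  then have "s \<le> vec.dim (orth X \<inter> C)" using X(3) s by (simp add: Int_commute)
  moreover have "vec.dim (orth X) = ?n - ?k + s"
    using X(2,3) vec.dim_eq_card_independent[OF X(2)] s kn by (simp add: dim_orth)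
  ultimately show "\<exists>A. galois_closed q A \<and> s \<le> vec.dim (A \<inter> C) \<and> vec.dim A = ?n - ?k + s"
    using galois_closed_orth[OF X(1)] by blast
next
  let ?n = "CARD('n)" and ?k = "vec.dim C"
  fix d assume "\<exists>A. galois_closed q A \<and> s \<le> vec.dim (A \<inter> C) \<and> vec.dim A = d"
  then obtain B where B: "galois_closed q B" "s \<le> vec.dim (B \<inter> C)" "vec.dim B = d" by blast
  have kn: "?k \<le> ?n" by (rule dim_subset_UNIV_cart_gen)
  have dn: "d \<le> ?n" using dim_subset_UNIV_cart_gen[of B] B(3) by simp
  have sB: "vec.subspace B" using B(1) by (simp add: galois_closed_def)
  show "?n - ?k + s \<le> d"
  proof (rule ccontr)
    assume neg: "\<not> ?n - ?k + s \<le> d"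
    have "galois_closed q (orth (B \<inter> rational))" by (rule galois_closed_orth) simp
    moreover have "orth (B \<inter> rational) = orth B" using galois_descent[OF B(1)] orth_span by metis
    ultimately obtain Y where Y: "Y \<subseteq> orth B \<inter> rational" "vec.independent Y"
      "card Y = vec.dim (orth B)"
      using galois_closed_basis by metis
    then have "?k - s + 1 \<le> card Y" using neg s kn B(3) by (simp add: dim_orth)
    then obtain Z where Z: "Z \<subseteq> Y" "card Z = ?k - s + 1"
      by (meson obtain_subset_with_card_n)
    let ?E = "{b + c |b c. b \<in> B \<and> c \<in> C}" and ?Z = "vec.span Z"
    have "vec.dim ?E + vec.dim (B \<inter> C) = d + ?k"
      using vec.dim_sums_Int[OF sB C] B(3) by simp
    then have dE: "vec.dim ?E + s \<le> d + ?k" using B(2) by simp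
    have "vec.independent Z" using Y(2) Z(1) by (rule vec.independent_mono)
    then have dZ: "vec.dim ?Z = ?k - s + 1" using Z(2) vec.dim_span_eq_card_independent by metis
    \<comment> \<open>Both spaces lie in \<open>orth B\<close>, of dimension \<open>n - d\<close>,
      while their dimensions add up to at least \<open>n - d + 1\<close>.\<close>
    have "vec.dim {x + y |x y. x \<in> ?Z \<and> y \<in> orth ?E} + vec.dim (?Z \<inter> orth ?E)
        = vec.dim ?Z + vec.dim (orth ?E)"
      by (rule vec.dim_sums_Int[OF vec.subspace_span subspace_orth])
    moreover have "vec.dim {x + y |x y. x \<in> ?Z \<and> y \<in> orth ?E} \<le> vec.dim (orth B)"
    proof (rule vec.dim_subset)
      have "?Z \<subseteq> orth B" using Z(1) Y(1) by (intro vec.span_minimal subspace_orth) auto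
      moreover have "B \<subseteq> ?E" using vec.subspace_0[OF C] by force
      then have "orth ?E \<subseteq> orth B" by (auto simp: orth_def)
      ultimately show "{x + y |x y. x \<in> ?Z \<and> y \<in> orth ?E} \<subseteq> orth B"
        using vec.subspace_add[OF subspace_orth] by blast
    qed
    ultimately have "vec.dim (?Z \<inter> orth ?E) \<noteq> 0"
      using dZ dE B(3) neg s kn dn by (simp add: dim_orth del: vec.dim_eq_0)
    then obtain x where x: "x \<in> ?Z" "x \<in> orth ?E" "x \<noteq> 0" unfolding vec.dim_eq_0 by blast
    have "C \<subseteq> ?E" using vec.subspace_0[OF sB] by force
    then have "x \<in> orth C" using x(2) by (auto simp: orth_def)
    then have "?k \<le> rank_weight emb x" using dual x(3) by blast
    also have "\<dots> \<le> ?k - s + 1"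
      using rank_weight_le_card[of Z x] x(1) Y(1) Z by auto
    \<comment> \<open>Here \<open>s \<ge> 2\<close> matters: it makes \<open>k - s + 1\<close>
      smaller than \<open>k\<close>.\<close>
    finally show False using s by simp
  qed
qed

section \<open>Minimum distance and the bound on the length\<close>

lemma min_rank_distance_attained:
  assumes "vec.subspace C" and "vec.dim C > 0"
  obtains c where "c \<in> C" "c \<noteq> 0" "rank_weight emb c = min_rank_distance emb C"
proof -
  \<comment> \<open>A nonzero codeword makes the \<open>LEAST\<close> an attained minimum instead of
    an unspecified number.\<close>
  have "\<not> C \<subseteq> {0}" using assms(2) vec.dim_eq_0[of C] by (simp del: vec.dim_eq_0)
  then obtain c where "c \<in> C" "c \<noteq> 0" by auto
  then have "\<exists>d. \<exists>c\<in>C. c \<noteq> 0 \<and> rank_weight emb c = d" by blast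
  then have "\<exists>c\<in>C. c \<noteq> 0 \<and> rank_weight emb c = min_rank_distance emb C"
    unfolding min_rank_distance_def by (rule LeastI_ex)
  then show ?thesis using that by blast
qed

lemma min_rank_distance_le: "c \<in> C \<Longrightarrow> c \<noteq> 0 \<Longrightarrow> min_rank_distance emb C \<le> rank_weight emb c"
  unfolding min_rank_distance_def by (rule Least_le) blast

lemma near_MRD_dual_distance:
  fixes C :: "('a^'n) set"
  assumes "near_MRD emb k C" and "2 \<le> k" and "x \<in> orth C" and "x \<noteq> 0"
  shows "k \<le> rank_weight emb x"
proof -
  have C: "vec.subspace C" "vec.dim C = k" and
    gen: "gen_rank_weight q 2 C = CARD('n) - k + 2"
    using assms(1,2) by (auto simp: near_MRD_def rank_code_def card_base)
  have "CARD('n) - k + 2 \<le> vec.dim A" if "galois_closed q A" "2 \<le> vec.dim (A \<inter> C)" for A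
    unfolding gen[symmetric] gen_rank_weight_def by (rule Least_le) (use that in blast)
  then show ?thesis
    using dual_distance_of_second_weight[OF C(1), of x] C(2) assms(2-4) by simp
qed

lemma near_MRD_bound:
  fixes C :: "('a^'n) set"
  assumes near: "near_MRD emb k C" and k: "1 \<le> k"
  shows "k \<le> m \<and> CARD('n) \<le> (if m = 2 * k - 2 then m + 2 else m + 1)"
proof -
  let ?n = "CARD('n)"
  have C: "vec.subspace C" "vec.dim C = k" and d: "min_rank_distance emb C = ?n - k"
    using near by (auto simp: near_MRD_def rank_code_def)
  obtain c where c: "c \<in> C" "c \<noteq> 0" "rank_weight emb c = ?n - k"
    by (rule min_rank_distance_attained[OF C(1)]) (use C(2) k d in simp_all)
  \<comment> \<open>Read off from a codeword of minimum weight. It makes the dual nonzero, and for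
    \<open>k = 1\<close> it already gives both claims.\<close>
  have d1: "1 \<le> ?n - k" "?n - k \<le> m"
    using rank_weight_pos[OF c(2)] rank_weight_le_degree[of c] c(3) by auto
  show ?thesis
  proof (cases "k = 1")
    case True
    then show ?thesis using d1 by auto
  next
    case False
    then have k2: "2 \<le> k" using k by simp
    have dual: "k \<le> rank_weight emb x" if "x \<in> orth C" "x \<noteq> 0" for x
      using near_MRD_dual_distance[OF near k2] that .
    have dd: "vec.dim (orth C) = ?n - k" by (simp add: dim_orth C(2))
    then have "vec.dim (orth C) \<noteq> 0" using d1 by simp
    then obtain x where "x \<in> orth C" "x \<noteq> 0" by auto
    \<comment> \<open>Any nonzero dual word has weight at least \<open>k\<close> and at most
      \<open>m\<close>.\<close>
    then have km: "k \<le> m" using dual rank_weight_le_degree le_trans by blast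
    have *: "m * (?n - k) + ?n * (k - 1) \<le> ?n * m"
      using singleton_bound[OF subspace_orth[of C], of k] dual km k dd by simp
    have **: "m * k + ?n * (?n - k - 1) \<le> ?n * m"
      using singleton_bound[OF C(1), of "?n - k"] min_rank_distance_le[of _ C] d d1 C(2) by simp
    have "?n = m + 2 \<and> m = 2 * k - 2" if nm: "m + 2 \<le> ?n"
    proof -
      \<comment> \<open>These substitutions remove truncated subtraction before the nonlinear
        arithmetic.\<close>
      define j t r where "j = k - 2" and "t = ?n - m - 2" and "r = ?n - k - 1"
      have kj: "k = j + 2" and nt: "?n = m + t + 2" and rr: "m + t = j + r + 1"
        and nk: "?n - k = Suc r"
        using k2 nm d1 by (simp_all add: j_def t_def r_def)
      have "m * Suc r + (m + t + 2) * (j + 1) \<le> (m + t + 2) * m"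
        using * by (simp only: nk) (simp add: kj nt)
      moreover have "m * (j + 2) + (m + t + 2) * r \<le> (m + t + 2) * m"
        using ** by (simp only: nk) (simp add: kj nt)
      ultimately have "t = 0 \<and> m = 2 * j + 2"
        using rr km kj by (intro singleton_pair_arith) simp_all
      then show ?thesis using nt kj by simp
    qed
    then show ?thesis using km by (cases "m + 2 \<le> ?n") auto
  qed
qed

section \<open>Systems\<close>

lemma rational_closed:
  "0 \<in> rational" "x \<in> rational \<Longrightarrow> y \<in> rational \<Longrightarrow> x + y \<in> rational"
  "x \<in> rational \<Longrightarrow> base_vscale emb c x \<in> rational"
  unfolding rational_def base_vscale_def
  by (auto simp: image_iff simp flip: emb_0 emb_add emb_mult) (metis emb_0 emb_add emb_mult)+

lemma matrix_base_vscale: "G *v base_vscale emb c x = base_vscale emb c (G *v x)"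
  by (simp add: base_vscale_def vec.scale)

lemma base_subspace_image_rational:
  fixes G :: "'a^'n^'k"
  shows "Fq_subspace emb ((*v) G ` rational)"
proof -
  interpret W: finite_vector_space "base_vscale emb :: 'f \<Rightarrow> 'a^'k \<Rightarrow> 'a^'k"
    by (rule finite_vector_space_base_vec)
  show ?thesis
  proof (rule W.subspaceI)
    show "0 \<in> (*v) G ` rational" using rational_closed(1) by (metis image_eqI matrix_vector_mult_0_right)
    show "x + y \<in> (*v) G ` rational" if "x \<in> (*v) G ` rational" "y \<in> (*v) G ` rational" for x y
      using that rational_closed(2) by (auto simp flip: matrix_vector_right_distrib intro!: imageI)
    show "base_vscale emb c x \<in> (*v) G ` rational" if "x \<in> (*v) G ` rational" for c x
      using that rational_closed(3) by (auto simp flip: matrix_base_vscale intro!: imageI)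
  qed
qed

lemma column_eq_mult_axis:
  fixes G :: "'a^'n^'k"
  shows "column i G = G *v axis i 1"
proof -
  have "(\<Sum>l\<in>UNIV. G $ j $ l * axis i 1 $ l) = (\<Sum>l\<in>UNIV. if l = i then G $ j $ i else 0)" for j
    by (rule sum.cong) (auto simp: axis_def)
  then show ?thesis by (simp add: vec_eq_iff column_def matrix_vector_mult_def)
qed

text \<open>Columns are the images of the axis vectors, and base field combinations of axis vectors
  are exactly the rational vectors. In this form a system is a linear image, and the kernel of
  \<open>G\<close> is the dual code.\<close>

lemma base_span_columns:
  fixes G :: "'a^'n^'k"
  shows "Fq_span emb (columns G) = (*v) G ` rational"
proof -
  interpret W: finite_vector_space "base_vscale emb :: 'f \<Rightarrow> 'a^'k \<Rightarrow> 'a^'k"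
    by (rule finite_vector_space_base_vec)
  show ?thesis
  proof
    show "W.span (columns G) \<subseteq> (*v) G ` rational"
    proof (rule W.span_minimal[OF _ base_subspace_image_rational])
      have "axis i 1 \<in> rational" for i :: 'n
        using emb_0 emb_one by (force simp: rational_def axis_def image_iff)
      then show "columns G \<subseteq> (*v) G ` rational"
        by (auto simp: columns_def column_eq_mult_axis)
    qed
    show "(*v) G ` rational \<subseteq> W.span (columns G)"
    proof clarify
      fix v :: "'a^'n" assume v: "v \<in> rational"
      have "v $ i *s column i G \<in> W.span (columns G)" for i
      proof -
        have "v $ i \<in> range emb" using v by (simp add: rational_def)
        then obtain c where "v $ i = emb c" by blast
        then have "v $ i *s column i G = base_vscale emb c (column i G)"
          by (simp add: base_vscale_def)
        then show ?thesis by (auto simp: columns_def intro: W.span_scale W.span_base)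
      qed
      then show "G *v v \<in> W.span (columns G)" by (simp add: matrix_mult_sum W.span_sum)
    qed
  qed
qed

text \<open>\<open>k - 1\<close> independent vectors of the system inside a \<open>(k - 2)\<close>-dimensional space are the
  images of rational vectors with a nontrivial combination in the kernel of \<open>G\<close>, that is, a dual
  word of rank weight below \<open>k\<close>.\<close>

lemma scattered_iff_dual_distance:
  fixes G :: "'a^'n^'k"
  assumes k: "2 \<le> CARD('k)" "CARD('k) \<le> CARD('n)"
    and dim: "Fq_dim emb ((*v) G ` rational) = CARD('n)"
  shows "scattered emb (CARD('k) - 2) ((*v) G ` rational) \<longleftrightarrow>
    (\<forall>x. G *v x = 0 \<and> x \<noteq> 0 \<longrightarrow> CARD('k) \<le> rank_weight emb x)"
proof -
  interpret W: finite_vector_space "base_vscale emb :: 'f \<Rightarrow> 'a^'k \<Rightarrow> 'a^'k"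
    by (rule finite_vector_space_base_vec)
  let ?k = "CARD('k)" and ?U = "(*v) G ` rational"
  \<comment> \<open>Full dimension \<open>n\<close> means that \<open>G\<close> is injective on
    rational vectors, although it may have a kernel over the extension.\<close>
  have "card ?U = card (rational :: ('a^'n) set)"
    using W.card_subspace[OF base_subspace_image_rational[of G]] dim
    by (simp add: card_rational card_base)
  then have inj: "inj_on ((*v) G) rational" by (intro eq_card_imp_inj_on) auto
  have card_Int: "card (?U \<inter> W) = q ^ Fq_dim emb (?U \<inter> W)" if "vec.subspace W" for W :: "('a^'k) set"
  proof -
    have "W.subspace W"
      using that by (auto simp: W.subspace_def vec.subspace_def base_vscale_def)
    then show ?thesis
      using W.card_subspace[OF W.subspace_inter[OF base_subspace_image_rational]]
      by (simp add: card_base)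
  qed
  show ?thesis
  proof
    assume sc: "scattered emb (?k - 2) ?U"
    show "\<forall>x. G *v x = 0 \<and> x \<noteq> 0 \<longrightarrow> ?k \<le> rank_weight emb x"
    proof (intro allI impI, rule ccontr)
      fix x assume x: "G *v x = 0 \<and> x \<noteq> 0" and "\<not> ?k \<le> rank_weight emb x"
      then have "rank_weight emb x \<le> ?k - 1" by simp
      then obtain X where X: "X \<subseteq> rational" "vec.independent X" "card X = ?k - 1" "x \<in> vec.span X"
        by (rule rank_weight_le_obtains) (use k in simp)
      obtain u where u: "x = (\<Sum>b\<in>X. u b *s b)" using X(4) by (auto simp: vec.span_finite)
      obtain b where b: "b \<in> X" "u b \<noteq> 0" using x u by (metis (no_types, lifting) sum.neutral
            vec.scale_zero_left)
      have "0 = (\<Sum>a\<in>X. u a *s (G *v a))" using x by (simp add: u vec.sum vec.scale)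
      also have "\<dots> = u b *s (G *v b) + (\<Sum>a\<in>X-{b}. u a *s (G *v a))"
        using b(1) by (intro sum.remove) auto
      finally have "u b *s (G *v b) = - (\<Sum>a\<in>X-{b}. u a *s (G *v a))"
        by (simp add: eq_neg_iff_add_eq_0)
      also have "\<dots> \<in> vec.span ((*v) G ` (X - {b}))"
        by (intro vec.span_neg vec.span_sum vec.span_scale vec.span_base) auto
      finally have "inverse (u b) *s (u b *s (G *v b)) \<in> vec.span ((*v) G ` (X - {b}))"
        by (rule vec.span_scale)
      then have "G *v b \<in> vec.span ((*v) G ` (X - {b}))" using b(2) by simp
      then have "(*v) G ` X \<subseteq> vec.span ((*v) G ` (X - {b}))"
        by (auto intro: vec.span_base)
      then have "vec.dim ((*v) G ` X) \<le> card ((*v) G ` (X - {b}))"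
        by (rule vec.dim_le_card) simp
      also have "\<dots> \<le> card (X - {b})" by (rule card_image_le) simp
      also have "\<dots> = ?k - 2" using b(1) X(3) by (simp add: card_Diff_singleton)
      finally have "vec.dim ((*v) G ` X) \<le> ?k - 2" .
      then obtain B where B: "vec.independent B" "(*v) G ` X \<subseteq> vec.span B" "card B \<le> ?k - 2"
        using vec.basis_exists[of "(*v) G ` X"] by metis
      \<comment> \<open>The images may span less than \<open>k - 2\<close> dimensions, whereas
        scatteredness tests dimension exactly \<open>k - 2\<close>; so \<open>B\<close> is padded to
        \<open>Y\<close>.\<close>
      have eB: "card (vec.extend_basis B) = ?k"
        using vec.dim_span_eq_card_independent[OF vec.independent_extend_basis[OF B(1)]] B(1)
        by (simp add: vec_dim_card del: vec.dim_UNIV)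
      then obtain Y where Y: "B \<subseteq> Y" "Y \<subseteq> vec.extend_basis B" "card Y = ?k - 2"
        using exists_subset_between[of B "?k - 2" "vec.extend_basis B"] B
          vec.extend_basis_superset[OF B(1)] by auto
      have "vec.independent Y"
        using vec.independent_extend_basis[OF B(1)] Y(2) by (rule vec.independent_mono)
      then have dY: "vec.dim (vec.span Y) = ?k - 2"
        using Y(3) vec.dim_span_eq_card_independent by metis
      have "(*v) G ` vec.span X \<subseteq> vec.span Y"
        using B(2) vec.span_mono[OF Y(1)] vec.span_minimal[OF _ vec.subspace_span]
        by (metis subset_trans vec.span_image)
      then have "(*v) G ` (rational \<inter> vec.span X) \<subseteq> ?U \<inter> vec.span Y" by blast
      then have "card ((*v) G ` (rational \<inter> vec.span X)) \<le> card (?U \<inter> vec.span Y)"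
        by (intro card_mono) auto
      moreover have "card ((*v) G ` (rational \<inter> vec.span X)) = q ^ (?k - 1)"
        using inj_on_subset[OF inj] card_rational_Int_span[OF X(1,2)] X(3)
        by (simp add: card_image)
      ultimately have "?k - 1 \<le> Fq_dim emb (?U \<inter> vec.span Y)"
        using q_gt_1 by (simp add: card_Int)
      moreover have "Fq_dim emb (?U \<inter> vec.span Y) \<le> ?k - 2"
        using sc dY by (simp add: scattered_def)
      ultimately show False using k by simp
    qed
  next
    assume dual: "\<forall>x. G *v x = 0 \<and> x \<noteq> 0 \<longrightarrow> ?k \<le> rank_weight emb x"
    show "scattered emb (?k - 2) ?U"
      unfolding scattered_def
    proof (intro conjI allI impI)
      fix W :: "('a^'k) set" assume W: "vec.subspace W \<and> vec.dim W = ?k - 2"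
      \<comment> \<open>\<open>L\<close> is the rational preimage of \<open>W\<close>. It is
        controlled by a maximal subset \<open>X\<close> independent over the extension, which bounds
        the size of \<open>L\<close> by \<open>q ^ card X\<close>.\<close>
      define L where "L = {v \<in> rational. G *v v \<in> W}"
      obtain X where X: "X \<subseteq> L" "vec.independent X" "L \<subseteq> vec.span X"
        using vec.maximal_independent_subset by blast
      have Xr: "X \<subseteq> rational" using X(1) by (auto simp: L_def)
      have "card X \<le> ?k - 2"
      proof (rule ccontr)
        assume "\<not> card X \<le> ?k - 2"
        then have "?k - 1 \<le> card X" by simp
        then obtain Y where Y: "Y \<subseteq> X" "card Y = ?k - 1"
          by (meson obtain_subset_with_card_n)
        have iY: "vec.independent Y" using X(2) Y(1) by (rule vec.independent_mono)
        have "(*v) G ` Y \<subseteq> W" using X(1) Y(1) by (auto simp: L_def)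
        then have "vec.dim ((*v) G ` Y) \<le> ?k - 2" using W vec.dim_subset by metis
        moreover have "vec.dim Y = ?k - 1" using iY Y(2) vec.dim_eq_card_independent by metis
        \<comment> \<open>Mapping \<open>k - 1\<close> independent rational vectors into dimension
          \<open>k - 2\<close> yields a nonzero kernel vector in their span, of rank weight at most
          \<open>k - 1\<close>.\<close>
        ultimately have "\<not> inj_on ((*v) G) (vec.span Y)"
          using vec.dim_image_eq[of "(*v) G" Y] k(1) by auto
        then obtain v w where vw: "v \<in> vec.span Y" "w \<in> vec.span Y" "G *v v = G *v w" "v \<noteq> w"
          by (auto simp: inj_on_def)
        then have "G *v (v - w) = 0" "v - w \<in> vec.span Y"
          by (auto simp: vec.diff vec.span_diff)
        then have "?k \<le> rank_weight emb (v - w)" "rank_weight emb (v - w) \<le> card Y"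
          using dual vw(4) rank_weight_le_card[of Y] Y(1) Xr by auto
        then show False using Y(2) k(1) by simp
      qed
      moreover have "card (?U \<inter> W) \<le> q ^ card X"
      proof -
        have "?U \<inter> W = (*v) G ` L" by (auto simp: L_def)
        then have "card (?U \<inter> W) \<le> card L" by (simp add: card_image_le)
        also have "\<dots> \<le> card (rational \<inter> vec.span X)"
          using X(3) by (intro card_mono) (auto simp: L_def)
        finally show ?thesis using card_rational_Int_span[OF Xr X(2)] by simp
      qed
      then have "Fq_dim emb (?U \<inter> W) \<le> card X"
        using card_Int[of W] W q_gt_1 by simp
      ultimately show "Fq_dim emb (?U \<inter> W) \<le> ?k - 2" by simp
    qed (use k in simp)
  qed
qed

section \<open>The equivalence for length \<open>2 * k\<close> and degree
  \<open>2 * k - 2\<close>\<close>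

lemma near_MRD_iff_dual_distance:
  fixes C :: "('a^'n) set"
  assumes C: "vec.subspace C" "vec.dim C = k" and k: "2 \<le> k"
    and n: "CARD('n) = 2 * k" and m: "m = 2 * k - 2"
  shows "near_MRD emb k C \<and> min_rank_distance emb C = k \<longleftrightarrow>
    (\<forall>x. x \<in> orth C \<and> x \<noteq> 0 \<longrightarrow> k \<le> rank_weight emb x)"
proof
  assume "near_MRD emb k C \<and> min_rank_distance emb C = k"
  then show "\<forall>x. x \<in> orth C \<and> x \<noteq> 0 \<longrightarrow> k \<le> rank_weight emb x"
    using near_MRD_dual_distance[of k C] k by blast
next
  assume dual: "\<forall>x. x \<in> orth C \<and> x \<noteq> 0 \<longrightarrow> k \<le> rank_weight emb x"
  have km: "1 \<le> k" "k \<le> m" using k m by auto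
  have dd: "vec.dim (orth C) = k" by (simp add: dim_orth C(2) n)
  obtain j where j: "k = j + 2" using k by (metis le_add_diff_inverse2)
  \<comment> \<open>The dual has dimension \<open>k\<close> and distance at least \<open>k\<close>,
    so it meets the Singleton bound; duality then gives codewords weight at least
    \<open>m + 2 - k = k\<close>.\<close>
  have eq: "m * vec.dim (orth C) + CARD('n) * (k - 1) = CARD('n) * m"
    unfolding dd n m j by (simp add: algebra_simps)
  have lower: "k \<le> rank_weight emb c" if "c \<in> C" "c \<noteq> 0" for c
  proof -
    have "c \<in> orth (orth C)" using that(1) by (simp add: orth_orth[OF C(1)])
    then have "m + 2 \<le> rank_weight emb c + k"
      using singleton_equality_dual[OF subspace_orth _ km eq] dual that(2) by blast
    then show ?thesis using m k by simp
  qed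
  obtain c where "c \<in> C" "c \<noteq> 0" "rank_weight emb c = min_rank_distance emb C"
    by (rule min_rank_distance_attained[OF C(1)]) (use C(2) k in simp_all)
  then have ge: "k \<le> min_rank_distance emb C" using lower by metis
  have "min_rank_distance emb C \<le> k"
  proof (rule ccontr)
    assume "\<not> min_rank_distance emb C \<le> k"
    then have dist: "k + 1 \<le> rank_weight emb x" if "x \<in> C" "x \<noteq> 0" for x
      using min_rank_distance_le[OF that] by simp
    \<comment> \<open>Distance \<open>k + 1\<close> must be admissible for the Singleton bound,
      which then reads \<open>2 * k \<le> m\<close> after cancelling \<open>k\<close>.\<close>
    have "k + 1 \<le> m"
      using dist[OF \<open>c \<in> C\<close> \<open>c \<noteq> 0\<close>] rank_weight_le_degree[of c] by simp
    then have "m * k + 2 * k * k \<le> 2 * k * m"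
      using singleton_bound[OF C(1) dist] by (simp add: C(2) n)
    then show False unfolding m j by (simp add: algebra_simps)
  qed
  with ge have d: "min_rank_distance emb C = k" by simp
  have "gen_rank_weight q s C = CARD('n) - k + s" if "2 \<le> s" "s \<le> k" for s
    using gen_rank_weight_of_dual_distance[OF C(1), of s] dual that C(2) by simp
  then show "near_MRD emb k C \<and> min_rank_distance emb C = k"
    using C d n by (simp add: near_MRD_def rank_code_def card_base)
qed

text \<open>The change of basis is absorbed into \<open>transpose M ** G\<close>, which has the same
  kernel as \<open>G\<close> because \<open>M\<close> is invertible. So every associated system
  comes from a matrix whose kernel is the dual code.\<close>

lemma associated_systems_eq:
  assumes "U \<in> associated_systems emb (C :: ('a^'n) set)"
  obtains G :: "'a^'n^'k" where "U = (*v) G ` rational" "\<And>x. x \<in> orth C \<longleftrightarrow> G *v x = 0"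
proof -
  obtain G :: "'a^'n^'k" and M :: "'a^'k^'k" where
    U: "U = (\<lambda>u. u v* M) ` Fq_span emb (columns G)" and G: "generator_matrix G C"
    and M: "invertible M"
    using assms unfolding associated_systems_def by blast
  have "U = (*v) (transpose M ** G) ` rational"
    by (simp add: U base_span_columns image_image matrix_vector_mul_assoc[symmetric])
  moreover have "G *v x = 0 \<longleftrightarrow> (transpose M ** G) *v x = 0" for x
  proof -
    have "\<exists>B. B ** transpose M = mat 1"
      using M unfolding left_invertible_transpose invertible_right_inverse .
    then have "inj ((*v) (transpose M))" unfolding matrix_left_invertible_injective .
    then have "transpose M *v y = 0 \<longleftrightarrow> y = 0" for y
      using injD[of "(*v) (transpose M)" y 0] by auto
    then show ?thesis by (simp add: matrix_vector_mul_assoc[symmetric])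
  qed
  ultimately show ?thesis using that[of "transpose M ** G"] generator_matrix_orth[OF G] by simp
qed

text \<open>For each associated system the property is equivalent to one condition on
  \<open>C\<close> alone, so all systems agree. Nondegeneracy provides one system, which keeps the
  universal statement from being vacuous.\<close>

lemma maximum_scattered_iff_dual_distance:
  fixes C :: "('a^'n) set"
  assumes "vec.dim C = CARD('k)" and nd: "nondegenerate TYPE('k::finite) emb C"
    and k: "2 \<le> CARD('k)" and n: "CARD('n) = 2 * CARD('k)" and m: "m = 2 * CARD('k) - 2"
  shows "(\<forall>U :: ('a^'k) set. rank_system emb CARD('n) U \<and> U \<in> associated_systems emb C \<longrightarrow>
      maximum_scattered emb m (CARD('k) - 2) U) \<longleftrightarrow>
    (\<forall>x. x \<in> orth C \<and> x \<noteq> 0 \<longrightarrow> CARD('k) \<le> rank_weight emb x)"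
proof -
  have iff: "maximum_scattered emb m (CARD('k) - 2) U \<longleftrightarrow>
      (\<forall>x. x \<in> orth C \<and> x \<noteq> 0 \<longrightarrow> CARD('k) \<le> rank_weight emb x)"
    if U: "rank_system emb CARD('n) U" "U \<in> associated_systems emb C" for U :: "('a^'k) set"
  proof -
    obtain G :: "'a^'n^'k" where G: "U = (*v) G ` rational" "\<And>x. x \<in> orth C \<longleftrightarrow> G *v x = 0"
      using associated_systems_eq[OF U(2)] by blast
    have dim: "Fq_dim emb U = CARD('n)" using U(1) by (simp add: rank_system_def)
    obtain j where j: "CARD('k) = j + 2" using k by (metis le_add_diff_inverse2)
    \<comment> \<open>Since \<open>m = 2 * (k - 1)\<close>, the required size
      \<open>k * m / (k - 1)\<close> is \<open>2 * k = n\<close>, so being maximum adds nothing to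
      being scattered.\<close>
    have "real (Fq_dim emb U) = real (CARD('k) * m) / real (CARD('k) - 2 + 1)"
      by (simp add: dim n m j field_simps)
    then have "maximum_scattered emb m (CARD('k) - 2) U \<longleftrightarrow> scattered emb (CARD('k) - 2) U"
      by (simp add: maximum_scattered_def)
    also have "\<dots> \<longleftrightarrow> (\<forall>x. x \<in> orth C \<and> x \<noteq> 0 \<longrightarrow> CARD('k) \<le> rank_weight emb x)"
      using scattered_iff_dual_distance[of G] dim k n by (simp add: G)
    finally show ?thesis .
  qed
  obtain G :: "'a^'n^'k" where G: "generator_matrix G C"
    and dim: "Fq_dim emb (Fq_span emb (columns G)) = CARD('n)"
    using nd unfolding nondegenerate_def by blast
  let ?U = "Fq_span emb (columns G)"
  have "?U \<in> associated_systems emb C"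
    unfolding associated_systems_def using G
    by (intro CollectI exI[of _ G] exI[of _ "mat 1"]) (simp add: invertible_def)
  moreover have "rank_system emb CARD('n) ?U"
  proof -
    interpret W: finite_vector_space "base_vscale emb :: 'f \<Rightarrow> 'a^'k \<Rightarrow> 'a^'k"
      by (rule finite_vector_space_base_vec)
    have "vec.span (columns G) \<subseteq> vec.span ?U" by (rule vec.span_mono) (rule W.span_superset)
    then show ?thesis
      using generator_matrix_span_columns[OF G assms(1)] dim
      by (auto simp: rank_system_def W.subspace_span)
  qed
  ultimately show ?thesis using iff by blast
qed

end

theorem theorem5p5:
  fixes emb :: "'f::{field,finite} \<Rightarrow> 'a::{field,finite}"
    and C :: "('a^'n::finite) set"
    and q m n k :: nat
  assumes "primepow q" and "m > 0" and "n > 0" and "k > 0" and "k \<le> n"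
    and "CARD('f) = q" and "CARD('a) = q ^ m" and "field_embedding emb"
    and "CARD('n) = n" and "CARD('k::finite) = k"
  shows "(near_MRD emb k C \<longrightarrow>
            k \<le> m \<and> n \<le> (if m = 2 * k - 2 then m + 2 else m + 1)) \<and>
         (k \<ge> 2 \<and> n = 2 * k \<and> m = 2 * k - 2 \<and> rank_code k C \<and> nondegenerate TYPE('k) emb C \<longrightarrow>
            (near_MRD emb k C \<and> min_rank_distance emb C = k \<longleftrightarrow>
             (\<forall>U :: ('a^'k) set. rank_system emb n U \<and> U \<in> associated_systems emb C \<longrightarrow>
                maximum_scattered emb m (k - 2) U)))"
proof -
  interpret finite_extension emb q m
    using assms by (simp add: finite_extension_def finite_extension_axioms_def)
  show ?thesis
  proof (intro conjI[OF impI impI])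
    assume "near_MRD emb k C"
    then show "k \<le> m \<and> n \<le> (if m = 2 * k - 2 then m + 2 else m + 1)"
      using near_MRD_bound[of k C] assms(4,9) by simp
  next
    assume *: "k \<ge> 2 \<and> n = 2 * k \<and> m = 2 * k - 2 \<and> rank_code k C \<and> nondegenerate TYPE('k) emb C"
    then have C: "vec.subspace C" "vec.dim C = k" by (auto simp: rank_code_def)
    have "near_MRD emb k C \<and> min_rank_distance emb C = k \<longleftrightarrow>
        (\<forall>x. x \<in> orth C \<and> x \<noteq> 0 \<longrightarrow> k \<le> rank_weight emb x)"
      using near_MRD_iff_dual_distance[OF C] * assms(9) by simp
    also have "\<dots> \<longleftrightarrow> (\<forall>U :: ('a^'k) set. rank_system emb n U \<and> U \<in> associated_systems emb C \<longrightarrow>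
        maximum_scattered emb m (k - 2) U)"
      using maximum_scattered_iff_dual_distance[where 'k='k and C=C] * C(2) assms(9,10) by simp
    finally show "near_MRD emb k C \<and> min_rank_distance emb C = k \<longleftrightarrow>
      (\<forall>U :: ('a^'k) set. rank_system emb n U \<and> U \<in> associated_systems emb C \<longrightarrow>
        maximum_scattered emb m (k - 2) U)" .
  qed
qed

end
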